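(* For any distinct prime numbers $p,q$ and natural numbers $n,m\ge 1$, $$Cl_2(\mathbb{Z}_{p^nq^m})\cong Sh^{|U'(\mathbb{Z}_{p^nq^m})|}_{(p^n-p^{n-1})(q^m-q^{m-1})}.$$
   Context: $\mathbb{Z}_N$ is the ring of integers modulo $N$. For a ring $R$ with identity, $Id(R)$ is the set of idempotents, $U(R)$ the set of units, and $U'(R)=\{u\in U(R):u^2=1\}$. $Cl_2(R)$ is the simple undirected graph with vertex set $\{(e,u): e\in Id(R)\setminus\{0\},\ u\in U(R)\}$, in which two distinct vertices $(e,u)$ and $(f,v)$ are adjacent if and only if $ef=fe=0$ or $uv=vu=1$. Shuriken graph: for $t=2^k$ with $k\in\mathbb{Z}^+\cup\{0\}$ and $n$ a multiple of $t$, $Sh^t_n$ is (up to isomorphism) the simple graph with vertex set $\{a_i,b_i,c_i: i=1,\dots,n\}$ and edge set $$\{a_ib_j: i,j\in\{1,\dots,n\}\}\cup\{a_ic_i,\ b_ic_i: i=1,\dots,t\}\cup\{a_ic_{n+t+1-i},\ b_ic_{n+t+1-i}: t+1\le i\le n\}\cup\left\{a_ia_{n+t+1-i},\ b_ib_{n+t+1-i},\ c_ic_{n+t+1-i}: t+1\le i\le \tfrac{n+t}{2}\right\}.$$ *)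

theory Defs
  imports "HOL-Number_Theory.Residues" "Graph_Theory.Graph_Theory"
begin

text \<open>
  Simple undirected graphs are rendered, as in Graph_Theory, as symmetric loop-free pair digraphs:
  an undirected edge between x and y is the pair of arcs (x, y) and (y, x).
\<close>

definition idempotents :: "('a, 'b) ring_scheme \<Rightarrow> 'a set" where
  "idempotents R = {e \<in> carrier R. e \<otimes>\<^bsub>R\<^esub> e = e}"

definition involutory_units :: "('a, 'b) ring_scheme \<Rightarrow> 'a set" where
  "involutory_units R = {u \<in> Units R. u [^]\<^bsub>R\<^esub> (2::nat) = \<one>\<^bsub>R\<^esub>}"

definition clean_graph2 :: "('a, 'b) ring_scheme \<Rightarrow> ('a \<times> 'a) pair_pre_digraph" where
  "clean_graph2 R =
    (let V = (idempotents R - {\<zero>\<^bsub>R\<^esub>}) \<times> Units R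
     in \<lparr> pverts = V,
          parcs = {((e, u), (f, v)) | e u f v.
            (e, u) \<in> V \<and> (f, v) \<in> V \<and> (e, u) \<noteq> (f, v) \<and>
            ((e \<otimes>\<^bsub>R\<^esub> f = \<zero>\<^bsub>R\<^esub> \<and> f \<otimes>\<^bsub>R\<^esub> e = \<zero>\<^bsub>R\<^esub>) \<or>
             (u \<otimes>\<^bsub>R\<^esub> v = \<one>\<^bsub>R\<^esub> \<and> v \<otimes>\<^bsub>R\<^esub> u = \<one>\<^bsub>R\<^esub>))} \<rparr>)"

datatype shuriken_vertex = Va nat | Vb nat | Vc nat

text \<open>
  The bound (n + t) / 2 on i is written without division, so that it is the bound on
  rationals also for odd n + t. The definition makes sense for all t and n, but only
  the case where t is a power of 2 dividing n is intended.
\<close>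

definition shuriken_edges :: "nat \<Rightarrow> nat \<Rightarrow> shuriken_vertex set set" where
  "shuriken_edges t n =
     {{Va i, Vb j} | i j. i \<in> {1..n} \<and> j \<in> {1..n}} \<union>
     (\<Union>i\<in>{1..t}. {{Va i, Vc i}, {Vb i, Vc i}}) \<union>
     (\<Union>i\<in>{t+1..n}. {{Va i, Vc (n + t + 1 - i)}, {Vb i, Vc (n + t + 1 - i)}}) \<union>
     (\<Union>i\<in>{i. t + 1 \<le> i \<and> 2 * i \<le> n + t}.
        {{Va i, Va (n + t + 1 - i)}, {Vb i, Vb (n + t + 1 - i)}, {Vc i, Vc (n + t + 1 - i)}})"

definition shuriken :: "nat \<Rightarrow> nat \<Rightarrow> shuriken_vertex pair_pre_digraph" where
  "shuriken t n =
     \<lparr> pverts = Va ` {1..n} \<union> Vb ` {1..n} \<union> Vc ` {1..n},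
       parcs = {(x, y). {x, y} \<in> shuriken_edges t n} \<rparr>"

lemma clean_graph2_simple: "pair_bidirected_digraph (clean_graph2 R)"
  by unfold_locales
     (auto simp: clean_graph2_def Let_def symmetric_def intro!: symI)

lemma shuriken_simple:
  assumes "t \<le> n"
  shows "pair_graph (shuriken t n)"
proof -
  let ?V = "pverts (shuriken t n)" and ?E = "parcs (shuriken t n)"
  have sub: "?E \<subseteq> ?V \<times> ?V"
    using assms
    by (auto simp: shuriken_def shuriken_edges_def doubleton_eq_iff image_iff)
  have fin: "finite ?V" by (simp add: shuriken_def)
  then have "finite ?E" using sub by (meson finite_SigmaI finite_subset)
  moreover have "x \<noteq> y" if "(x, y) \<in> ?E" for x y
    using that by (auto simp: shuriken_def shuriken_edges_def doubleton_eq_iff)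
  moreover have "sym ?E" by (auto simp: sym_def shuriken_def insert_commute)
  ultimately show ?thesis
    using sub fin by unfold_locales (auto simp: symmetric_def)
qed

end

theory Submission
  imports Defs "HOL-Algebra.Sylow"
begin

text \<open>
  Adjacency in the clean graph depends on two coordinates separately. Modulo
  \<open>p\<^sup>n q\<^sup>m\<close> an idempotent is congruent to 0 or 1 modulo each of the two prime powers, because
  \<open>x\<close> and \<open>x - 1\<close> are coprime; so by the Chinese remainder theorem the idempotents are
  0, 1 and a complementary pair \<open>e\<close>, \<open>f\<close> with \<open>e f = 0\<close>. Among 1, \<open>e\<close>, \<open>f\<close> this is the only
  vanishing product. Hence the vertices fall into three layers, each a copy of the units: every
  vertex of the \<open>e\<close> layer is joined to every vertex of the \<open>f\<close> layer, and all other edges join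
  \<open>(x, u)\<close> to \<open>(y, u\<^sup>-\<^sup>1)\<close>.

  The shuriken graph has the same shape. The layers are the letters \<open>a\<close>, \<open>b\<close>, \<open>c\<close>, and inversion
  is played by the map that fixes \<open>1, \<dots>, t\<close> and reverses \<open>t + 1, \<dots>, n\<close>. So an isomorphism
  amounts to a numbering of the units that turns inversion into this map, and such a numbering
  exists for every involution with exactly \<open>t\<close> fixed points on a set of \<open>n\<close> elements
  (\<open>involution_numbering\<close>). The fixed points of inversion are the involutory units, which gives
  the isomorphism for every commutative ring with these four idempotents
  (\<open>clean_graph2_iso_shuriken\<close>).

  Finally, the involutory units form a subgroup of exponent at most 2 of the unit group. By
  Sylow's theorem 2 is the only prime that can divide the order of such a group, and by
  Lagrange's theorem the order divides the number of units, which is Euler's totient of the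
  modulus.
\<close>

section \<open>Isomorphisms of simple graphs\<close>

lemma digraph_iso_with_projI:
  assumes sub: "parcs G \<subseteq> pverts G \<times> pverts G" "parcs H \<subseteq> pverts H \<times> pverts H"
    and bij: "bij_betw \<phi> (pverts G) (pverts H)"
    and arcs: "\<And>x y. x \<in> pverts G \<Longrightarrow> y \<in> pverts G \<Longrightarrow>
                 (x, y) \<in> parcs G \<longleftrightarrow> (\<phi> x, \<phi> y) \<in> parcs H"
  shows "digraph_iso (with_proj G) (with_proj H)"
proof -
  let ?f = "\<lparr>iso_verts = \<phi>, iso_arcs = map_prod \<phi> \<phi>, iso_head = snd, iso_tail = fst\<rparr>"
  have inj: "inj_on \<phi> (pverts G)" and img: "\<phi> ` pverts G = pverts H"
    using bij by (auto simp: bij_betw_def)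
  have "wf_digraph (with_proj G)"
    using sub(1) by unfold_locales auto
  moreover have "inj_on (map_prod \<phi> \<phi>) (parcs G)"
    using map_prod_inj_on[OF inj inj] sub(1) by (rule inj_on_subset)
  ultimately have "pre_digraph.digraph_isomorphism (with_proj G) ?f"
    using inj by (auto simp: pre_digraph.digraph_isomorphism_def)
  moreover have "map_prod \<phi> \<phi> ` parcs G = parcs H"
  proof
    show "map_prod \<phi> \<phi> ` parcs G \<subseteq> parcs H"
      using sub(1) arcs by auto
    show "parcs H \<subseteq> map_prod \<phi> \<phi> ` parcs G"
    proof (rule subrelI)
      fix x' y' assume xy': "(x', y') \<in> parcs H"
      then have "x' \<in> \<phi> ` pverts G" "y' \<in> \<phi> ` pverts G"
        using sub(2) img by auto
      then obtain x y where "x \<in> pverts G" "y \<in> pverts G" "x' = \<phi> x" "y' = \<phi> y"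
        by auto
      with xy' arcs show "(x', y') \<in> map_prod \<phi> \<phi> ` parcs G" by force
    qed
  qed
  then have "with_proj H = app_iso ?f (with_proj G)"
    using img by (auto simp: with_proj_def app_iso_def)
  ultimately show ?thesis by (auto simp: digraph_iso_def)
qed

section \<open>Numbering a finite set along an involution\<close>

text \<open>
  Inversion as it is built into the shuriken graph: on \<open>1, \<dots>, n\<close> it fixes \<open>1, \<dots>, t\<close> and
  reverses the order of the rest.
\<close>

definition reflect :: "nat \<Rightarrow> nat \<Rightarrow> nat \<Rightarrow> nat" where
  "reflect t n i = (if i \<le> t then i else n + t + 1 - i)"

text \<open>
  Any two involutions on sets of equal size with equally many fixed points are conjugate; this is
  the case where one of them is \<open>reflect\<close>. In the induction a pair \<open>x\<close>, \<open>s x\<close> of distinct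
  elements is removed and then put back at the two ends \<open>t + 1\<close> and \<open>n + 2\<close> of the reversed
  block, where \<open>n\<close> is the size of the remaining set. The old numbers of that block move up by
  one, so that \<open>i\<close> and \<open>n + t + 1 - i\<close> become \<open>i + 1\<close> and \<open>(n + 2) + t + 1 - (i + 1)\<close>.
\<close>

lemma involution_numbering:
  assumes "finite S"
    and "\<And>x. x \<in> S \<Longrightarrow> s x \<in> S" and "\<And>x. x \<in> S \<Longrightarrow> s (s x) = x"
  shows "\<exists>h. bij_betw h S {1..card S} \<and>
           (\<forall>x\<in>S. h (s x) = reflect (card {x \<in> S. s x = x}) (card S) (h x))"
  using assms
proof (induction "card S" arbitrary: S rule: less_induct)
  case less
  show ?case
  proof (cases "\<forall>x\<in>S. s x = x")
    case True
    then have "{x \<in> S. s x = x} = S" by blast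
    moreover obtain g where g: "bij_betw g {1..card S} S"
      using ex_bij_betw_nat_finite_1[OF less.prems(1)] by blast
    moreover have "reflect (card S) (card S) (inv_into {1..card S} g x) = inv_into {1..card S} g x"
      if "x \<in> S" for x
      using bij_betwE[OF bij_betw_inv_into[OF g]] that by (auto simp: reflect_def)
    ultimately show ?thesis
      using True bij_betw_inv_into[OF g] by metis
  next
    case False
    then obtain x where x: "x \<in> S" "s x \<noteq> x" by blast
    define S' where "S' = S - {x, s x}"
    define t where "t = card {y \<in> S. s y = y}"
    define n where "n = card S'"
    have sx: "s x \<in> S" "s (s x) = x" using less.prems x by auto
    have fin: "finite S'" using less.prems by (simp add: S'_def)
    have S: "S = insert x (insert (s x) S')" using x sx by (auto simp: S'_def)
    have nS: "card S = n + 2"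
      using x fin unfolding n_def by (subst S) (simp add: S'_def)
    have fixed: "{y \<in> S'. s y = y} = {y \<in> S. s y = y}"
      using x sx by (auto simp: S'_def)
    have closed: "s y \<in> S'" if "y \<in> S'" for y
      using that less.prems sx unfolding S'_def by (metis Diff_iff insert_iff singletonD)
    have "\<exists>h. bij_betw h S' {1..card S'} \<and>
            (\<forall>y\<in>S'. h (s y) = reflect (card {y \<in> S'. s y = y}) (card S') (h y))"
    proof (rule less.hyps)
      show "card S' < card S" using nS n_def by simp
      show "s (s y) = y" if "y \<in> S'" for y using that less.prems by (auto simp: S'_def)
    qed (use fin closed in auto)
    then obtain h where h: "bij_betw h S' {1..n}" "\<And>y. y \<in> S' \<Longrightarrow> h (s y) = reflect t n (h y)"
      unfolding fixed t_def n_def by blast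
    have range: "1 \<le> h y" "h y \<le> n" if "y \<in> S'" for y
      using bij_betwE[OF h(1)] that by auto
    have t: "t \<le> n"
      unfolding t_def n_def fixed[symmetric] by (rule card_mono) (use fin in auto)
    define k where "k y = (if y = x then t + 1 else if y = s x then n + 2
                           else if h y \<le> t then h y else h y + 1)" for y
    have k: "k x = t + 1" "k (s x) = n + 2"
        "\<And>y. y \<in> S' \<Longrightarrow> k y = (if h y \<le> t then h y else h y + 1)"
      using x by (auto simp: k_def S'_def)
    have "k ` S \<subseteq> {1..card S}"
      unfolding nS unfolding S using range t by (auto simp: k le_SucI)
    moreover have "inj_on k S"
    proof -
      have "inj_on k S'"
        using h(1) by (auto simp: bij_betw_def inj_on_def k split: if_splits)
      moreover have "k y \<noteq> t + 1" "k y \<noteq> n + 2" if "y \<in> S'" for y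
        using range[OF that] that by (auto simp: k)
      ultimately show ?thesis
        using t unfolding S inj_on_insert by (force simp: k(1,2))
    qed
    ultimately have "bij_betw k S {1..card S}"
      by (simp add: bij_betw_def card_image card_subset_eq)
    moreover have "k (s y) = reflect t (card S) (k y)" if y: "y \<in> S" for y
    proof -
      consider "y = x" | "y = s x" | "y \<in> S'" using y unfolding S by blast
      then show ?thesis
      proof cases
        case 3
        then show ?thesis
          using range[OF 3] h(2)[OF 3] k(3)[OF 3] k(3)[OF closed[OF 3]] t
          by (auto simp: nS reflect_def split: if_splits)
      qed (use t in \<open>auto simp: nS k sx reflect_def\<close>)
    qed
    ultimately show ?thesis unfolding t_def by blast
  qed
qed

section \<open>Adjacency in the shuriken graph\<close>

text \<open>
  The edges inside a layer are listed only from their smaller end \<open>k\<close>, as \<open>2 k \<le> n + t\<close>. The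
  condition \<open>i \<noteq> j\<close> excludes the fixed points of \<open>reflect\<close>, among them the midpoint of the
  reversed block when that block has odd length.
\<close>

lemma shuriken_edges_same_letter:
  assumes "t \<le> n" "i \<in> {1..n}" "j \<in> {1..n}"
  shows "{Va i, Va j} \<in> shuriken_edges t n \<longleftrightarrow> i \<noteq> j \<and> j = reflect t n i"
    "{Vb i, Vb j} \<in> shuriken_edges t n \<longleftrightarrow> i \<noteq> j \<and> j = reflect t n i"
    "{Vc i, Vc j} \<in> shuriken_edges t n \<longleftrightarrow> i \<noteq> j \<and> j = reflect t n i"
proof -
  have pair: "(\<exists>k. t + 1 \<le> k \<and> 2 * k \<le> n + t \<and>
          (i = k \<and> j = n + t + 1 - k \<or> i = n + t + 1 - k \<and> j = k)) \<longleftrightarrow>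
        i \<noteq> j \<and> j = reflect t n i" (is "?L \<longleftrightarrow> ?R")
  proof
    assume ?L
    then show ?R using assms by (auto simp: reflect_def)
  next
    assume r: ?R
    show ?L
    proof (cases "i < j")
      case True
      then show ?thesis using r by (intro exI[of _ i]) (auto simp: reflect_def split: if_splits)
    next
      case False
      then show ?thesis using r assms
        by (intro exI[of _ j]) (auto simp: reflect_def split: if_splits)
    qed
  qed
  show "{Va i, Va j} \<in> shuriken_edges t n \<longleftrightarrow> i \<noteq> j \<and> j = reflect t n i"
    unfolding pair[symmetric] by (simp add: shuriken_edges_def doubleton_eq_iff Bex_def)
  show "{Vb i, Vb j} \<in> shuriken_edges t n \<longleftrightarrow> i \<noteq> j \<and> j = reflect t n i"
    unfolding pair[symmetric] by (simp add: shuriken_edges_def doubleton_eq_iff Bex_def)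
  show "{Vc i, Vc j} \<in> shuriken_edges t n \<longleftrightarrow> i \<noteq> j \<and> j = reflect t n i"
    unfolding pair[symmetric] by (simp add: shuriken_edges_def doubleton_eq_iff Bex_def)
qed

lemma shuriken_edges_different_letters:
  assumes "i \<in> {1..n}" "j \<in> {1..n}"
  shows "{Va i, Vb j} \<in> shuriken_edges t n"
    "{Va i, Vc j} \<in> shuriken_edges t n \<longleftrightarrow> j = reflect t n i"
    "{Vb i, Vc j} \<in> shuriken_edges t n \<longleftrightarrow> j = reflect t n i"
proof -
  have pair: "(\<exists>k. 1 \<le> k \<and> k \<le> t \<and> i = k \<and> j = k) \<or>
      (\<exists>k. t + 1 \<le> k \<and> k \<le> n \<and> i = k \<and> j = n + t + 1 - k) \<longleftrightarrow> j = reflect t n i"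
    using assms by (auto simp: reflect_def)
  show "{Va i, Vb j} \<in> shuriken_edges t n"
    using assms unfolding shuriken_edges_def by blast
  show "{Va i, Vc j} \<in> shuriken_edges t n \<longleftrightarrow> j = reflect t n i"
    unfolding pair[symmetric] by (simp add: shuriken_edges_def doubleton_eq_iff Bex_def)
  show "{Vb i, Vc j} \<in> shuriken_edges t n \<longleftrightarrow> j = reflect t n i"
    unfolding pair[symmetric] by (simp add: shuriken_edges_def doubleton_eq_iff Bex_def)
qed

lemma reflect_eq_iff:
  assumes "t \<le> n" "i \<in> {1..n}" "j \<in> {1..n}"
  shows "j = reflect t n i \<longleftrightarrow> i = reflect t n j"
  using assms by (auto simp: reflect_def)

text \<open>
  In this form the shuriken graph can be compared with a clean graph: two vertices in layers
  other than the pair \<open>a\<close>, \<open>b\<close> are adjacent if and only if they are distinct and their indices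
  correspond under \<open>reflect\<close>.
\<close>

lemma shuriken_arcs_iff:
  assumes "t \<le> n" "i \<in> {1..n}" "j \<in> {1..n}"
  shows "(Va i, Vb j) \<in> parcs (shuriken t n)" "(Vb i, Va j) \<in> parcs (shuriken t n)"
    "(Va i, Vc j) \<in> parcs (shuriken t n) \<longleftrightarrow> j = reflect t n i"
    "(Vc i, Va j) \<in> parcs (shuriken t n) \<longleftrightarrow> j = reflect t n i"
    "(Vb i, Vc j) \<in> parcs (shuriken t n) \<longleftrightarrow> j = reflect t n i"
    "(Vc i, Vb j) \<in> parcs (shuriken t n) \<longleftrightarrow> j = reflect t n i"
    "(Va i, Va j) \<in> parcs (shuriken t n) \<longleftrightarrow> i \<noteq> j \<and> j = reflect t n i"
    "(Vb i, Vb j) \<in> parcs (shuriken t n) \<longleftrightarrow> i \<noteq> j \<and> j = reflect t n i"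
    "(Vc i, Vc j) \<in> parcs (shuriken t n) \<longleftrightarrow> i \<noteq> j \<and> j = reflect t n i"
  using shuriken_edges_same_letter[OF assms] shuriken_edges_different_letters[OF assms(2,3)]
    shuriken_edges_different_letters[OF assms(3,2)] reflect_eq_iff[OF assms]
  unfolding shuriken_def by (simp_all add: insert_commute)

section \<open>Rings with exactly four idempotents\<close>

context cring
begin

lemma Units_inverse_iff:
  assumes "u \<in> Units R" "v \<in> Units R"
  shows "u \<otimes> v = \<one> \<longleftrightarrow> v = inv u"
  using assms by (metis Units_closed Units_r_inv comm_inv_char)

lemma involutory_units_eq: "involutory_units R = {u \<in> Units R. inv u = u}"
  unfolding involutory_units_def
  using Units_inverse_iff by (auto simp: numeral_2_eq_2 Units_closed)

text \<open>
  The layers of \<open>e\<close> and \<open>f\<close> go to the letters \<open>a\<close> and \<open>b\<close>, which are completely joined because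
  \<open>e f = 0\<close>. The layer of the identity goes to \<open>c\<close>: the product of the identity with a nonzero
  idempotent never vanishes, so only inverse units give edges there.
\<close>

theorem clean_graph2_iso_shuriken:
  assumes fin: "finite (Units R)"
    and idem: "idempotents R = {\<zero>, \<one>, e, f}" and dist: "distinct [\<zero>, \<one>, e, f]"
    and orth: "e \<otimes> f = \<zero>"
  shows "digraph_iso (with_proj (clean_graph2 R))
           (with_proj (shuriken (card (involutory_units R)) (card (Units R))))"
proof -
  define n where "n = card (Units R)"
  define t where "t = card (involutory_units R)"
  have t: "t \<le> n"
    unfolding t_def n_def involutory_units_def by (rule card_mono) (use fin in auto)
  obtain h where h: "bij_betw h (Units R) {1..n}"
      "\<And>u. u \<in> Units R \<Longrightarrow> h (inv u) = reflect t n (h u)"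
    using involution_numbering[of "Units R" "m_inv R"] fin
    unfolding t_def n_def involutory_units_eq by auto
  have inj: "h u = h v \<longleftrightarrow> u = v" if "u \<in> Units R" "v \<in> Units R" for u v
    using h(1) that by (auto simp: bij_betw_def inj_on_def)
  have range: "h u \<in> {1..n}" if "u \<in> Units R" for u
    using bij_betwE[OF h(1)] that by auto
  have verts: "pverts (clean_graph2 R) = {\<one>, e, f} \<times> Units R"
    using idem dist by (auto simp: clean_graph2_def Let_def)
  have carr: "e \<in> carrier R" "f \<in> carrier R" "e \<otimes> e = e" "f \<otimes> f = f"
    using idem by (auto simp: idempotents_def)
  have inverse: "u \<otimes> v = \<one> \<longleftrightarrow> h v = reflect t n (h u)"
    if "u \<in> Units R" "v \<in> Units R" for u v
    using that by (simp add: Units_inverse_iff inj flip: h(2))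
  define \<phi> where "\<phi> = (\<lambda>(x, u). if x = e then Va (h u) else if x = f then Vb (h u) else Vc (h u))"
  have \<phi>: "\<phi> (e, u) = Va (h u)" "\<phi> (f, u) = Vb (h u)" "\<phi> (\<one>, u) = Vc (h u)" for u
    using dist by (auto simp: \<phi>_def)
  have "digraph_iso (with_proj (clean_graph2 R)) (with_proj (shuriken t n))"
  proof (rule digraph_iso_with_projI)
    show "parcs (clean_graph2 R) \<subseteq> pverts (clean_graph2 R) \<times> pverts (clean_graph2 R)"
      by (auto simp: clean_graph2_def Let_def)
    interpret pair_graph "shuriken t n" using t by (rule shuriken_simple)
    show "parcs (shuriken t n) \<subseteq> pverts (shuriken t n) \<times> pverts (shuriken t n)"
      using in_arcsD1 in_arcsD2 by auto
    have "inj_on \<phi> ({\<one>, e, f} \<times> Units R)"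
      using dist by (auto simp: inj_on_def \<phi> inj)
    moreover have "\<phi> ` ({\<one>, e, f} \<times> Units R) = pverts (shuriken t n)"
    proof -
      have "{\<one>, e, f} \<times> Units R = Pair e ` Units R \<union> Pair f ` Units R \<union> Pair \<one> ` Units R"
        by auto
      then have "\<phi> ` ({\<one>, e, f} \<times> Units R) =
              Va ` h ` Units R \<union> Vb ` h ` Units R \<union> Vc ` h ` Units R"
        by (simp only: image_Un image_image \<phi>)
      then show ?thesis using h(1) by (simp add: bij_betw_def shuriken_def)
    qed
    ultimately show "bij_betw \<phi> (pverts (clean_graph2 R)) (pverts (shuriken t n))"
      unfolding verts bij_betw_def by blast
    fix a b assume "a \<in> pverts (clean_graph2 R)" "b \<in> pverts (clean_graph2 R)"
    then obtain x u y v where ab: "a = (x, u)" "b = (y, v)" "x \<in> {\<one>, e, f}" "y \<in> {\<one>, e, f}"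
        and uv: "u \<in> Units R" "v \<in> Units R"
      unfolding verts by auto
    have arc: "(a, b) \<in> parcs (clean_graph2 R) \<longleftrightarrow>
        (x, u) \<noteq> (y, v) \<and> (x \<otimes> y = \<zero> \<or> h v = reflect t n (h u))"
    proof -
      have comm: "y \<otimes> x = x \<otimes> y" "v \<otimes> u = u \<otimes> v"
        using ab uv carr by (auto intro!: m_comm simp: Units_closed)
      have "x \<in> idempotents R - {\<zero>}" "y \<in> idempotents R - {\<zero>}"
        using ab idem dist by auto
      then have "(a, b) \<in> parcs (clean_graph2 R) \<longleftrightarrow> (x, u) \<noteq> (y, v) \<and>
          (x \<otimes> y = \<zero> \<and> y \<otimes> x = \<zero> \<or> u \<otimes> v = \<one> \<and> v \<otimes> u = \<one>)"
        using ab(1,2) uv by (simp add: clean_graph2_def)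
      then show ?thesis
        unfolding comm inverse[OF uv] by simp
    qed
    have ne: "e \<noteq> f" "f \<noteq> e" "e \<noteq> \<one>" "f \<noteq> \<one>" "\<one> \<noteq> \<zero>" "e \<noteq> \<zero>" "f \<noteq> \<zero>"
      using dist by auto
    have fe: "f \<otimes> e = \<zero>" using orth carr m_comm by metis
    show "(a, b) \<in> parcs (clean_graph2 R) \<longleftrightarrow> (\<phi> a, \<phi> b) \<in> parcs (shuriken t n)"
      unfolding arc using ab(3,4)
      by (elim insertE emptyE)
        (simp_all add: ab(1,2) \<phi> shuriken_arcs_iff[OF t range[OF uv(1)] range[OF uv(2)]]
          orth fe carr inj[OF uv] ne ne[symmetric])
  qed
  then show ?thesis by (simp add: t_def n_def)
qed

end

section \<open>Counting involutory units\<close>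

text \<open>
  For a prime divisor \<open>r\<close> of the order, Sylow's theorem supplies a subgroup of order \<open>r\<close>. A
  nontrivial element of it has order 2 by assumption, and this order divides \<open>r\<close>.
\<close>

lemma (in group) order_eq_power_of_2:
  assumes fin: "finite (carrier G)" and exp: "\<And>x. x \<in> carrier G \<Longrightarrow> x [^] (2::nat) = \<one>"
  shows "\<exists>k. order G = 2 ^ k"
proof -
  have prime_factor: "r = 2" if r: "prime r" "r dvd order G" for r :: nat
  proof -
    obtain m where m: "order G = r ^ 1 * m" using r(2) by auto
    obtain H where H: "subgroup H G" "card H = r"
      using sylow_thm[OF r(1) is_group m fin] by auto
    have "\<not> H \<subseteq> {\<one>}"
      using H(2) prime_gt_1_nat[OF r(1)] card_mono[of "{\<one>}" H] by auto
    then obtain x where x: "x \<in> H" "x \<noteq> \<one>" by auto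
    have xG: "x \<in> carrier G" using H(1) x by (auto dest: subgroup.mem_carrier)
    have "ord x dvd 2" using exp[OF xG] pow_eq_id[OF xG] by simp
    moreover have "ord x \<noteq> 1" using x xG ord_eq_1 by simp
    ultimately have o: "ord x = 2" using two_is_prime_nat prime_nat_iff by metis
    interpret H: group "G\<lparr>carrier := H\<rparr>" using H(1) subgroup.subgroup_is_group is_group by blast
    have "x [^]\<^bsub>G\<lparr>carrier := H\<rparr>\<^esub> order (G\<lparr>carrier := H\<rparr>) = \<one>\<^bsub>G\<lparr>carrier := H\<rparr>\<^esub>"
      by (rule H.pow_order_eq_1) (use x in simp)
    then have "x [^] r = \<one>"
      using H(2) by (simp add: order_def flip: nat_pow_consistent)
    then have "2 dvd r" using pow_eq_id[OF xG] o by simp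
    then show ?thesis using r(1) two_is_prime_nat primes_dvd_imp_eq by blast
  qed
  have pos: "order G \<noteq> 0" using fin order_gt_0_iff_finite by simp
  obtain m where m: "order G = 2 ^ multiplicity 2 (order G) * m" "\<not> 2 dvd m"
    using multiplicity_decompose'[OF pos, of 2] by auto
  have "m = 1"
  proof (rule ccontr)
    assume "m \<noteq> 1"
    then obtain r where "prime r" "r dvd m" using prime_factor_nat by blast
    then show False using prime_factor[of r] m by (metis dvd_mult)
  qed
  then show ?thesis using m(1) by auto
qed

text \<open>
  Commutativity enters because the product of two involutions need not be one otherwise.
\<close>

lemma (in comm_group) card_involutions:
  assumes fin: "finite (carrier G)"
  defines "H \<equiv> {x \<in> carrier G. x [^] (2::nat) = \<one>}"
  shows "\<exists>k. card H = 2 ^ k" "card H dvd order G"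
proof -
  have sub: "subgroup H G"
    by (rule subgroupI) (auto simp: H_def nat_pow_inv nat_pow_distrib)
  show "card H dvd order G"
    using lagrange[OF sub] by (metis dvd_triv_right)
  interpret H: group "G\<lparr>carrier := H\<rparr>" using sub subgroup.subgroup_is_group is_group by blast
  have "\<exists>k. order (G\<lparr>carrier := H\<rparr>) = 2 ^ k"
    by (rule H.order_eq_power_of_2)
      (use fin in \<open>auto simp: H_def simp flip: nat_pow_consistent\<close>)
  then show "\<exists>k. card H = 2 ^ k" by (simp add: order_def)
qed

lemma (in cring) card_involutory_units:
  assumes "finite (Units R)"
  shows "\<exists>k. card (involutory_units R) = 2 ^ k" "card (involutory_units R) dvd card (Units R)"
proof -
  interpret U: comm_group "units_of R" by (rule units_comm_group)
  have "involutory_units R =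
      {u \<in> carrier (units_of R). u [^]\<^bsub>units_of R\<^esub> (2::nat) = \<one>\<^bsub>units_of R\<^esub>}"
    by (auto simp: involutory_units_def units_of_carrier units_of_one units_of_pow)
  then show "\<exists>k. card (involutory_units R) = 2 ^ k"
      "card (involutory_units R) dvd card (Units R)"
    using U.card_involutions assms by (simp_all add: order_def units_of_carrier)
qed

section \<open>Idempotents modulo a product of two prime powers\<close>

text \<open>
  The prime \<open>p\<close> cannot divide both \<open>x\<close> and \<open>x - 1\<close>, so the whole power divides one of them.
\<close>

lemma idempotent_mod_prime_power:
  fixes p x :: int
  assumes "prime p" "p ^ n dvd x * (x - 1)"
  shows "[x = 0] (mod p ^ n) \<or> [x = 1] (mod p ^ n)"
proof (cases "p dvd x")
  case True
  then have "\<not> p dvd x - 1"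
    using assms(1) dvd_diff[of p x "x - 1"] by auto
  then have "coprime (p ^ n) (x - 1)"
    using assms(1) by (simp add: prime_imp_coprime)
  then show ?thesis
    using assms(2) by (simp add: coprime_dvd_mult_left_iff cong_0_iff)
next
  case False
  then have "coprime (p ^ n) x"
    using assms(1) by (simp add: prime_imp_coprime)
  then show ?thesis
    using assms(2) by (simp add: coprime_dvd_mult_right_iff cong_iff_dvd_diff)
qed

text \<open>
  An idempotent modulo \<open>a b\<close> is determined by its residues modulo \<open>a\<close> and \<open>b\<close>. If 0 and 1 are
  the only idempotents modulo each factor, this leaves four cases, and all four occur: the
  pairs of residues \<open>(0, 0)\<close>, \<open>(1, 1)\<close>, \<open>(1, 0)\<close> and \<open>(0, 1)\<close> belong to 0, 1, \<open>e\<close>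
  and \<open>f = 1 - e\<close>.
\<close>

lemma idempotents_residue_ring:
  fixes a b :: int
  assumes "coprime a b" "a > 1" "b > 1"
    and local: "\<And>x. a dvd x * (x - 1) \<Longrightarrow> [x = 0] (mod a) \<or> [x = 1] (mod a)"
      "\<And>x. b dvd x * (x - 1) \<Longrightarrow> [x = 0] (mod b) \<or> [x = 1] (mod b)"
  defines "R \<equiv> residue_ring (a * b)"
  obtains e f where "idempotents R = {\<zero>\<^bsub>R\<^esub>, \<one>\<^bsub>R\<^esub>, e, f}"
    "distinct [\<zero>\<^bsub>R\<^esub>, \<one>\<^bsub>R\<^esub>, e, f]" "e \<otimes>\<^bsub>R\<^esub> f = \<zero>\<^bsub>R\<^esub>"
proof -
  have ab: "a * b > 1" using assms(2,3) by (metis less_1_mult)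
  interpret residues "a * b" R using ab by unfold_locales (simp_all add: R_def)
  obtain x where x: "[x = 1] (mod a)" "[x = 0] (mod b)"
    using binary_chinese_remainder_int[OF assms(1)] by blast
  define e where "e = x mod (a * b)"
  define f where "f = (1 - x) mod (a * b)"
  have e: "[e = 1] (mod a)" "[e = 0] (mod b)"
    using x by (auto simp: e_def cong_def mod_mod_cancel)
  have f: "[f = 0] (mod a)" "[f = 1] (mod b)"
    using cong_diff[OF cong_refl[of 1] x(1)] cong_diff[OF cong_refl[of 1] x(2)]
    by (auto simp: f_def cong_def mod_mod_cancel)
  have range: "e \<in> carrier R" "f \<in> carrier R" "0 \<in> carrier R" "1 \<in> carrier R"
    using ab by (auto simp: e_def f_def res_carrier_eq)
  have ne: "\<not> [0 = 1] (mod a)" "\<not> [0 = 1] (mod b)" "\<not> [1 = 0] (mod a)" "\<not> [1 = 0] (mod b)"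
    using assms(2,3) by (auto simp: cong_def)
  have eqI: "y = z" if "y \<in> carrier R" "z \<in> carrier R" "[y = z] (mod a)" "[y = z] (mod b)" for y z
    using coprime_cong_mult[OF that(3,4) assms(1)] that(1,2)
    by (simp add: res_carrier_eq cong_def)
  have idem: "y \<in> idempotents R \<longleftrightarrow> y \<in> carrier R \<and> a dvd y * (y - 1) \<and> b dvd y * (y - 1)" for y
  proof -
    have "y \<otimes>\<^bsub>R\<^esub> y = y \<longleftrightarrow> [y * y = y] (mod a * b)" if "y \<in> carrier R"
      using that by (simp add: res_mult_eq res_carrier_eq cong_def)
    also have "[y * y = y] (mod a * b) \<longleftrightarrow> a * b dvd y * (y - 1)"
      by (simp add: cong_iff_dvd_diff algebra_simps)
    also have "\<dots> \<longleftrightarrow> a dvd y * (y - 1) \<and> b dvd y * (y - 1)"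
      using assms(1) by (auto intro: divides_mult dvd_mult_left dvd_mult_right)
    finally show ?thesis by (auto simp: idempotents_def)
  qed
  have "a dvd e * (e - 1)" "b dvd e * (e - 1)" "a dvd f * (f - 1)" "b dvd f * (f - 1)"
    using e f by (auto simp: cong_iff_dvd_diff)
  then have "{0, 1, e, f} \<subseteq> idempotents R"
    using range by (auto simp: idem)
  moreover have "y \<in> {0, 1, e, f}" if "y \<in> idempotents R" for y
  proof -
    have y: "y \<in> carrier R" "[y = 0] (mod a) \<or> [y = 1] (mod a)" "[y = 0] (mod b) \<or> [y = 1] (mod b)"
      using that idem local by auto
    then show ?thesis
      using eqI[OF y(1)] range e f by (metis cong_sym cong_trans insertCI)
  qed
  ultimately have "idempotents R = {0, 1, e, f}" by blast
  moreover have "distinct [0, 1, e, f]"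
  proof -
    have "e \<noteq> 0" "e \<noteq> 1" "f \<noteq> 0" "f \<noteq> 1" using e f ne cong_sym by blast+
    moreover have "e \<noteq> f" using e f ne cong_sym cong_trans by blast
    ultimately show ?thesis by auto
  qed
  moreover have "e \<otimes>\<^bsub>R\<^esub> f = 0"
  proof (rule eqI)
    show "[e \<otimes>\<^bsub>R\<^esub> f = 0] (mod a)" "[e \<otimes>\<^bsub>R\<^esub> f = 0] (mod b)"
      using e f by (auto simp: res_mult_eq cong_0_iff dvd_mod_iff)
  qed (use range in \<open>auto simp: res_mult_eq\<close>)
  ultimately show ?thesis
    using that by (simp add: res_zero_eq res_one_eq)
qed

theorem theorem3:
  fixes p q n m :: nat
  defines "R \<equiv> residue_ring (int (p ^ n * q ^ m))"
  defines "t \<equiv> card (involutory_units R)"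
  defines "N \<equiv> (p ^ n - p ^ (n - 1)) * (q ^ m - q ^ (m - 1))"
  assumes "prime p" and "prime q" and "p \<noteq> q" and "n \<ge> 1" and "m \<ge> 1"
  shows "(\<exists>k. t = 2 ^ k) \<and> t dvd N \<and>
    digraph_iso (with_proj (clean_graph2 R)) (with_proj (shuriken t N))"
proof -
  have gt: "p ^ n > 1" "q ^ m > 1"
    using assms(4-8) by (simp_all add: one_less_power prime_gt_1_nat del: One_nat_def)
  have cop: "coprime (p ^ n) (q ^ m)"
    using assms(4-6) by (simp add: primes_coprime)
  interpret residues "int (p ^ n * q ^ m)" R
    using less_1_mult[OF gt] by unfold_locales (simp_all add: R_def flip: of_nat_mult of_nat_power)
  have totient: "totient (r ^ k) = r ^ k - r ^ (k - 1)" if "prime r" "k \<ge> 1" for r k :: nat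
    using that power_minus_mult[of k r] by (simp add: totient_prime_power right_diff_distrib')
  have N: "card (Units R) = N"
  proof -
    have "card (Units R) = totient (p ^ n * q ^ m)"
      using totient_eq by (simp only: nat_int)
    also have "\<dots> = totient (p ^ n) * totient (q ^ m)"
      using cop by (rule totient_mult_coprime)
    also have "\<dots> = N"
      using totient[OF assms(4,7)] totient[OF assms(5,8)] by (simp add: N_def)
    finally show ?thesis .
  qed
  have int_pq: "coprime (int p ^ n) (int q ^ m)" "int p ^ n > 1" "int q ^ m > 1"
      "prime (int p)" "prime (int q)"
    using cop gt assms(4,5) by (simp_all flip: of_nat_power)
  have R: "R = residue_ring (int p ^ n * int q ^ m)"
    by (simp add: R_def)
  obtain e f where "idempotents R = {\<zero>\<^bsub>R\<^esub>, \<one>\<^bsub>R\<^esub>, e, f}"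
      "distinct [\<zero>\<^bsub>R\<^esub>, \<one>\<^bsub>R\<^esub>, e, f]" "e \<otimes>\<^bsub>R\<^esub> f = \<zero>\<^bsub>R\<^esub>"
    by (rule idempotents_residue_ring[OF int_pq(1-3) idempotent_mod_prime_power[OF int_pq(4)]
          idempotent_mod_prime_power[OF int_pq(5)], folded R])
  then show ?thesis
    using clean_graph2_iso_shuriken card_involutory_units unfolding t_def N[symmetric] by auto
qed

end
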